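(* Let $\mathcal R=\langle R\mid \nu,\mu\rangle$ be an $(m_r,n_r)$-ring, let $\mathsf G=\langle G\mid\mu_{\mathsf G}\rangle$ be an $n_g$-ary group, and let $S$ be the set of formal sums with coefficients in $R$ and basis $G$. Let $\ell_m\ge 1$ and let the addition of the polyadic group ring, an operation $\boldsymbol\nu:S^{M}\to S$ of arity $M$, be given componentwise with polyadic power $\ell_m$, that is $$\boldsymbol\nu\Big[\sum_{g} r_g(1)\bullet g,\ \ldots,\ \sum_g r_g(M)\bullet g\Big]=\sum_g \nu^{\circ \ell_m}\big[r_g(1),\ldots,r_g(M)\big]\bullet g ,$$ where each of the $M$ summands contributes exactly one argument to the iterated operation $\nu^{\circ\ell_m}$ at each $g$. Then $$M=\ell_m(m_r-1)+1 .$$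
   Context: All arities are integers $\ge 2$. An $n$-ary operation $\mu:X^n\to X$ is totally associative if, for all $x_1,\dots,x_{2n-1}\in X$, the value $\mu[x_1,\dots,x_{i-1},\mu[x_i,\dots,x_{i+n-1}],x_{i+n},\dots,x_{2n-1}]$ does not depend on $i\in\{1,\dots,n\}$; then $\langle X\mid\mu\rangle$ is an $n$-ary semigroup. For $\ell\ge1$, $\mu^{\circ\ell}$ denotes the $\ell$-fold composition of $\mu$ with itself (it contains $\ell$ copies of $\mu$; by associativity the bracketing is irrelevant); it takes exactly $\ell(n-1)+1$ arguments. An $n$-ary group is an $n$-ary semigroup in which (for $n\ge3$) every $x$ has a querelement $\bar x$, i.e. $\mu[\bar x,x,\dots,x]=x$ with $\bar x$ in any of the $n$ positions; for $n=2$ it is an ordinary group. An $(m_r,n_r)$-ring $\langle R\mid\nu,\mu\rangle$ is a set with an $m_r$-ary addition $\nu$ making $R$ a commutative $m_r$-ary group, and an $n_r$-ary multiplication $\mu$ making $R$ an $n_r$-ary semigroup, such that $\mu$ distributes over $\nu$ in each of its $n_r$ arguments. A polyadic zero of $\mathcal R$, if it exists, is an element $z_R\in R$ with $\nu[r,z_R,\dots,z_R]=r$ for all $r$ and with $\mu[r_1,\dots,r_{n_r}]=z_R$ whenever some $r_i=z_R$. Formal sums: an element of $S$ is a formal sum $\sum_{g\in G}r_g\bullet g$, i.e. a family $(r_g)_{g\in G}$ of elements of $R$. If $\mathcal R$ has a polyadic zero $z_R$, all but finitely many $r_g$ are required to equal $z_R$ (and such terms may be omitted); if $\mathcal R$ has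 no polyadic zero, $G$ is finite and all families are allowed. *)

theory Defs
  imports "HOL-Algebra.Group" "HOL-Library.NList" "HOL-Library.FuncSet" "HOL-Library.Multiset"
begin

text \<open>
  An operation \<open>X\<^sup>n \<rightarrow> X\<close> is a partial map on lists that is defined exactly on the lists
  of length \<open>n\<close> over \<open>X\<close>. Its arity is thus recorded by its domain: applied to a list of
  any other length it is undefined (\<open>None\<close>). All arities are at least 2.
\<close>

definition polyadic_op :: "nat \<Rightarrow> 'a set \<Rightarrow> ('a list \<rightharpoonup> 'a) \<Rightarrow> bool" where
  "polyadic_op n X f \<longleftrightarrow> 2 \<le> n \<and> dom f = nlists n X \<and> ran f \<subseteq> X"

abbreviation app :: "('a list \<rightharpoonup> 'a) \<Rightarrow> 'a list \<Rightarrow> 'a" where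
  "app f xs \<equiv> the (f xs)"

text \<open>Underlying sets of algebraic structures are nonempty.\<close>

definition polyadic_semigroup :: "nat \<Rightarrow> 'a set \<Rightarrow> ('a list \<rightharpoonup> 'a) \<Rightarrow> bool" where
  "polyadic_semigroup n X f \<longleftrightarrow> polyadic_op n X f \<and> X \<noteq> {} \<and>
     (\<forall>xs \<in> nlists (2 * n - 1) X. \<forall>i<n. \<forall>j<n.
        app f (take i xs @ [app f (take n (drop i xs))] @ drop (i + n) xs) =
        app f (take j xs @ [app f (take n (drop j xs))] @ drop (j + n) xs))"

definition querelement :: "nat \<Rightarrow> ('a list \<rightharpoonup> 'a) \<Rightarrow> 'a \<Rightarrow> 'a \<Rightarrow> bool" where
  "querelement n f x y \<longleftrightarrow> (\<forall>i<n. app f ((replicate n x)[i := y]) = x)"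

definition polyadic_group :: "nat \<Rightarrow> 'a set \<Rightarrow> ('a list \<rightharpoonup> 'a) \<Rightarrow> bool" where
  "polyadic_group n X f \<longleftrightarrow> polyadic_semigroup n X f \<and>
     (if n = 2
      then \<exists>e. group \<lparr>carrier = X, monoid.mult = (\<lambda>x y. app f [x, y]), one = e\<rparr>
      else \<forall>x\<in>X. \<exists>y\<in>X. querelement n f x y)"

definition commutative_op :: "nat \<Rightarrow> 'a set \<Rightarrow> ('a list \<rightharpoonup> 'a) \<Rightarrow> bool" where
  "commutative_op n X f \<longleftrightarrow>
     (\<forall>xs \<in> nlists n X. \<forall>ys \<in> nlists n X. mset xs = mset ys \<longrightarrow> app f xs = app f ys)"

definition distributes_over ::
  "nat \<Rightarrow> nat \<Rightarrow> 'a set \<Rightarrow> ('a list \<rightharpoonup> 'a) \<Rightarrow> ('a list \<rightharpoonup> 'a) \<Rightarrow> bool" where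
  "distributes_over n m X \<mu> \<nu> \<longleftrightarrow>
     (\<forall>xs \<in> nlists n X. \<forall>i<n. \<forall>ys \<in> nlists m X.
        app \<mu> (xs[i := app \<nu> ys]) = app \<nu> (map (\<lambda>y. app \<mu> (xs[i := y])) ys))"

definition polyadic_ring ::
  "nat \<Rightarrow> nat \<Rightarrow> 'a set \<Rightarrow> ('a list \<rightharpoonup> 'a) \<Rightarrow> ('a list \<rightharpoonup> 'a) \<Rightarrow> bool" where
  "polyadic_ring m n R \<nu> \<mu> \<longleftrightarrow>
     polyadic_group m R \<nu> \<and> commutative_op m R \<nu> \<and>
     polyadic_semigroup n R \<mu> \<and> distributes_over n m R \<mu> \<nu>"

definition polyadic_zero ::
  "nat \<Rightarrow> nat \<Rightarrow> 'a set \<Rightarrow> ('a list \<rightharpoonup> 'a) \<Rightarrow> ('a list \<rightharpoonup> 'a) \<Rightarrow> 'a \<Rightarrow> bool" where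
  "polyadic_zero m n R \<nu> \<mu> z \<longleftrightarrow> z \<in> R \<and>
     (\<forall>r\<in>R. app \<nu> (r # replicate (m - 1) z) = r) \<and>
     (\<forall>rs \<in> nlists n R. z \<in> set rs \<longrightarrow> app \<mu> rs = z)"

text \<open>
  Formal sums are families \<open>r :: 'g \<Rightarrow> 'a\<close> in \<open>G \<rightarrow>\<^sub>E R\<close>. A polyadic zero, if there is one, is
  unique. If there is none, the finiteness condition is void and all families are allowed.
\<close>

definition formal_sums ::
  "nat \<Rightarrow> nat \<Rightarrow> 'a set \<Rightarrow> ('a list \<rightharpoonup> 'a) \<Rightarrow> ('a list \<rightharpoonup> 'a) \<Rightarrow> 'g set \<Rightarrow> ('g \<Rightarrow> 'a) set" where
  "formal_sums m n R \<nu> \<mu> G =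
     {r \<in> G \<rightarrow>\<^sub>E R. \<forall>z. polyadic_zero m n R \<nu> \<mu> z \<longrightarrow> finite {g \<in> G. r g \<noteq> z}}"

text \<open>
  The \<open>l\<close>-fold composition of an \<open>n\<close>-ary operation with itself, bracketed to the left: one
  further copy of \<open>f\<close> takes the value of the previous composite as its first argument and
  the last \<open>n - 1\<close> entries of the list as its other arguments. No arity is imposed on the
  composite; its domain results from that of \<open>f\<close>. The case \<open>l = 0\<close> only starts the recursion.
\<close>

primrec op_power :: "nat \<Rightarrow> ('a list \<rightharpoonup> 'a) \<Rightarrow> nat \<Rightarrow> 'a list \<rightharpoonup> 'a" where
  "op_power n f 0 xs = (case xs of [x] \<Rightarrow> Some x | _ \<Rightarrow> None)"
| "op_power n f (Suc l) xs =
     (let k = length xs - (n - 1)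
      in Option.bind (op_power n f l (take k xs)) (\<lambda>y. f (y # drop k xs)))"

lemma op_power_1:
  assumes "polyadic_op n X f"
  shows "op_power n f 1 = f"
proof
  fix xs
  have n: "n \<ge> 2" and d: "dom f = nlists n X"
    using assms by (simp_all add: polyadic_op_def)
  have 1: "op_power n f 1 xs =
      (case take (length xs - (n - 1)) xs of [x] \<Rightarrow> f (x # drop (length xs - (n - 1)) xs) | _ \<Rightarrow> None)"
    by (simp add: Let_def split: list.split)
  show "op_power n f 1 xs = f xs"
  proof (cases "length xs = n")
    case True
    then obtain y ys where "xs = y # ys" "length ys = n - 1"
      using n by (cases xs) simp_all
    then show ?thesis unfolding 1 by simp
  next
    case False
    have len: "length (take (length xs - (n - 1)) xs) \<noteq> 1"
      using False n by simp
    have case_None: "(case ys of [x] \<Rightarrow> h x | _ \<Rightarrow> None) = None"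
      if "length ys \<noteq> 1" for ys :: "'a list" and h :: "'a \<Rightarrow> 'a option"
      proof (cases ys)
      case (Cons y zs)
      then show ?thesis using that by (cases zs) simp_all
    qed simp
    have "op_power n f 1 xs = None"
      unfolding 1 by (rule case_None[OF len])
    moreover have "f xs = None"
    proof -
      have "xs \<notin> nlists n X"
        using False by (auto simp only: nlists_def mem_Collect_eq)
      then show ?thesis
        unfolding d [symmetric] domIff by simp
    qed
    ultimately show ?thesis
      by (rule trans [OF _ sym])
  qed
qed

end

theory Submission imports Defs begin

text \<open>
  The arity is forced by domains alone. One copy of an \<open>n\<close>-ary operation turns \<open>n\<close> arguments into
  one value, so every further copy in an iterated composition raises the number of arguments by
  \<open>n - 1\<close>; hence the \<open>l\<close>-fold composite is undefined on every list whose length is not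
  \<open>l * (n - 1) + 1\<close> (lemma \<open>length_of_op_power_defined\<close>). The componentwise formula asserts that the
  composite is defined on lists of \<open>M\<close> coefficients, provided there is something to evaluate it
  on: a basis element and at least one formal sum. The basis is nonempty because it carries a
  polyadic group. A formal sum exists because the family that is constantly zero has empty support;
  here one uses that a polyadic zero is unique, since the product of two zeros has to equal both
  of them (lemmas \<open>polyadic_zero_unique\<close> and \<open>formal_sums_nonempty\<close>).
\<close>

text \<open>
  The domain of the operation determines the length of the block that its outermost copy consumes,
  and induction determines the length of the rest.
\<close>

lemma length_of_op_power_defined:
  assumes f: "polyadic_op n X f"
    and defined: "op_power n f l xs = Some y"
  shows "length xs = l * (n - 1) + 1"
  using defined
proof (induction l arbitrary: xs y)
  case 0
  then show ?case by (auto split: list.splits)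
next
  case (Suc l)
  define k where "k = length xs - (n - 1)"
  from Suc.prems obtain v where v: "op_power n f l (take k xs) = Some v"
    and outer: "f (v # drop k xs) = Some y"
    by (auto simp only: op_power.simps Let_def k_def bind_eq_Some_conv)
  have "length (take k xs) = l * (n - 1) + 1"
    using Suc.IH[OF v] .
  then have k: "k = l * (n - 1) + 1"
    by (simp add: k_def)
  have "v # drop k xs \<in> nlists n X"
    using domI[of f, OF outer] f by (simp only: polyadic_op_def)
  then have "length (v # drop k xs) = n"
    by (rule nlistsE_length)
  \<comment> \<open>As \<open>k\<close> is positive, the truncated difference in its definition is a true one.\<close>
  then show ?case using k unfolding k_def by simp
qed

lemma polyadic_zero_unique:
  assumes n: "2 \<le> n"
    and z: "polyadic_zero m n R \<nu> \<mu> z"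
    and w: "polyadic_zero m n R \<nu> \<mu> w"
  shows "z = w"
proof -
  let ?rs = "z # replicate (n - 1) w"
  have "z \<in> R" "w \<in> R"
    using z w by (simp_all add: polyadic_zero_def)
  then have "?rs \<in> nlists n R"
    by (intro nlistsI) (use n in auto)
  moreover have "z \<in> set ?rs" "w \<in> set ?rs"
    using n by auto
  ultimately have "app \<mu> ?rs = z" "app \<mu> ?rs = w"
    using z w unfolding polyadic_zero_def by blast+
  then show ?thesis by simp
qed

text \<open>
  The family that is constantly zero is a formal sum even over an infinite basis: by uniqueness of
  the zero, the finiteness condition concerns only the empty support. Without a polyadic zero
  there is no finiteness condition, and any constant family will do.
\<close>

lemma formal_sums_nonempty:
  assumes "2 \<le> n" and "R \<noteq> {}"
  shows "formal_sums m n R \<nu> \<mu> G \<noteq> {}"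
proof -
  obtain c where c: "c \<in> R"
    and zero: "\<And>z. polyadic_zero m n R \<nu> \<mu> z \<Longrightarrow> c = z"
  proof (cases "\<exists>z. polyadic_zero m n R \<nu> \<mu> z")
    case True
    then obtain z where z: "polyadic_zero m n R \<nu> \<mu> z" ..
    show ?thesis
    proof (rule that)
      show "z \<in> R" using z by (simp add: polyadic_zero_def)
      show "z = w" if "polyadic_zero m n R \<nu> \<mu> w" for w
        using assms(1) z that by (rule polyadic_zero_unique)
    qed
  next
    case False
    then show ?thesis using assms(2) that by blast
  qed
  have "(\<lambda>g\<in>G. c) \<in> formal_sums m n R \<nu> \<mu> G"
    using c zero by (auto simp: formal_sums_def)
  then show ?thesis by blast
qed

theorem theorem4p7:
  fixes R :: "'a set" and \<nu> \<mu> :: "'a list \<rightharpoonup> 'a"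
    and G :: "'g set" and \<mu>\<^sub>G :: "'g list \<rightharpoonup> 'g"
    and N :: "('g \<Rightarrow> 'a) list \<rightharpoonup> ('g \<Rightarrow> 'a)"
    and m\<^sub>r n\<^sub>r n\<^sub>g l\<^sub>m M :: nat
  assumes "polyadic_ring m\<^sub>r n\<^sub>r R \<nu> \<mu>"
    and "polyadic_group n\<^sub>g G \<mu>\<^sub>G"
    and "(\<nexists>z. polyadic_zero m\<^sub>r n\<^sub>r R \<nu> \<mu> z) \<Longrightarrow> finite G"
    and "l\<^sub>m \<ge> 1"
    and "polyadic_op M (formal_sums m\<^sub>r n\<^sub>r R \<nu> \<mu> G) N"
    and "\<And>rs g. rs \<in> nlists M (formal_sums m\<^sub>r n\<^sub>r R \<nu> \<mu> G) \<Longrightarrow> g \<in> G \<Longrightarrow>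
           op_power m\<^sub>r \<nu> l\<^sub>m (map (\<lambda>r. r g) rs) = Some (app N rs g)"
  shows "M = l\<^sub>m * (m\<^sub>r - 1) + 1"
proof -
  have add_op: "polyadic_op m\<^sub>r R \<nu>" and "2 \<le> n\<^sub>r" and "R \<noteq> {}"
    using assms(1)
    by (simp_all add: polyadic_ring_def polyadic_group_def polyadic_semigroup_def polyadic_op_def)
  have "formal_sums m\<^sub>r n\<^sub>r R \<nu> \<mu> G \<noteq> {}"
    using \<open>2 \<le> n\<^sub>r\<close> \<open>R \<noteq> {}\<close> by (rule formal_sums_nonempty)
  then obtain r where r: "r \<in> formal_sums m\<^sub>r n\<^sub>r R \<nu> \<mu> G"
    by (meson ex_in_conv)
  obtain g where g: "g \<in> G"
    using assms(2) by (auto simp: polyadic_group_def polyadic_semigroup_def)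
  let ?rs = "replicate M r"
  have "?rs \<in> nlists M (formal_sums m\<^sub>r n\<^sub>r R \<nu> \<mu> G)"
    by (intro nlistsI) (use r in auto)
  then have "op_power m\<^sub>r \<nu> l\<^sub>m (map (\<lambda>r. r g) ?rs) = Some (app N ?rs g)"
    using g by (rule assms(6))
  then have "length (map (\<lambda>r. r g) ?rs) = l\<^sub>m * (m\<^sub>r - 1) + 1"
    by (rule length_of_op_power_defined[OF add_op])
  then show ?thesis by simp
qed

end
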